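(* Let $(G_m)_{m\ge0}$ be either the family of Erdős–Rényi random graphs $G_m=H(m,p)$ for a fixed $p\in(0,1]$, or the family of geometric random graphs $G_m=Q_m^{(\sigma,d)}(r)$ for fixed $d\ge1$, $\sigma\in[1,\infty]$ and $0<r\le1/2$. For each $m$, let $A_{G_m}$ be the adjacency matrix of $G_m$ and define the polynomials $\bar\Lambda_{G_m}(x)=E\bigl(\det(xI+A_{G_m})\bigr)$ and $\bar\Gamma_{G_m}(x)=E\bigl(\operatorname{per}(xI+A_{G_m})\bigr)$ (expectation taken coefficientwise). Then for every $n\ge1$, \[ \bar\Lambda_{G_n}(x)=x\,\bar\Lambda_{G_{n-1}}(x)+\sum_{q=2}^n(-1)^{q-1}\frac{(n-1)!}{(n-q)!}\,\Theta(G_n,q)\,\bar\Lambda_{G_{n-q}}(x), \] \[ \bar\Gamma_{G_n}(x)=x\,\bar\Gamma_{G_{n-1}}(x)+\sum_{q=2}^n\frac{(n-1)!}{(n-q)!}\,\Theta(G_n,q)\,\bar\Gamma_{G_{n-q}}(x), \] with initial conditions $\bar\Lambda_{G_0}(x)=\bar\Gamma_{G_0}(x)=1$.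
   Context: $H(n,p)$ is the random graph on $\{1,\dots,n\}$ in which each of the $\binom n2$ edges is present independently with probability $p$. The geometric random graph $Q_n^{(\sigma,d)}(r)$ has vertex set $\{1,\dots,n\}$, vertex $i$ being associated with a point $\mathbf x_i$, the points independent and uniform on the torus $T_d=\mathbb R^d/\mathbb Z^d$; distinct vertices $i,j$ are adjacent iff $\min_{\mathbf u\in\mathbb Z^d}\|\mathbf x_i-\mathbf x_j-\mathbf u\|_\sigma\le r$ ($L_\sigma$ norm). The adjacency matrix is the symmetric $0/1$ matrix with zero diagonal and $(i,j)$ entry $1$ iff $i,j$ are adjacent. $\operatorname{per}$ denotes the permanent. For $2\le q\le n$, $\Theta(G_n,q)$ is the probability that a fixed labeled cycle of length $q$ is present in $G_n$, i.e. that for fixed distinct vertices $y_1,\dots,y_q$ all of $\{y_i,y_{i+1}\}$ ($1\le i\le q-1$) and $\{y_q,y_1\}$ are edges (for $q=2$ a single edge); this probability does not depend on the chosen cycle. *)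

theory Defs
  imports "HOL-Probability.Probability" "Jordan_Normal_Form.Determinant"
begin

no_notation vec_index (infixl \<open>$\<close> 100)

text \<open>A graph on the vertices \<open>{1..n}\<close> is given by its set of edges, each edge being a
  two-element set of vertices; a random graph is given by its law, a measure on edge sets.\<close>

definition all_edges :: "nat \<Rightarrow> nat set set" where
  "all_edges n = {{i, j} | i j. i \<in> {1..n} \<and> j \<in> {1..n} \<and> i \<noteq> j}"

definition erdos_renyi :: "real \<Rightarrow> nat \<Rightarrow> nat set set measure" where
  "erdos_renyi p n =
     measure_pmf (map_pmf (\<lambda>f. {e \<in> all_edges n. f e})
       (Pi_pmf (all_edges n) False (\<lambda>_. bernoulli_pmf p)))"

definition lnorm :: "ereal \<Rightarrow> real ^ 'd::finite \<Rightarrow> real" where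
  "lnorm \<sigma> v =
     (if \<sigma> = \<infinity> then (MAX i. \<bar>v $ i\<bar>)
      else (\<Sum>i\<in>UNIV. \<bar>v $ i\<bar> powr real_of_ereal \<sigma>) powr (1 / real_of_ereal \<sigma>))"

text \<open>A point of the torus \<open>\<real>\<^sup>d / \<int>\<^sup>d\<close> is given by its representative in the half-open unit cube.
  The infimum in \<open>torus_dist\<close> is a minimum.\<close>

definition torus_uniform :: "(real ^ 'd::finite) measure" where
  "torus_uniform = uniform_measure lborel {x. \<forall>i. 0 \<le> x $ i \<and> x $ i < 1}"

definition torus_dist :: "ereal \<Rightarrow> real ^ 'd::finite \<Rightarrow> real ^ 'd \<Rightarrow> real" where
  "torus_dist \<sigma> x y = (INF u\<in>{u. \<forall>i. u $ i \<in> \<int>}. lnorm \<sigma> (x - y - u))"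

definition geometric_edges ::
    "ereal \<Rightarrow> real \<Rightarrow> nat \<Rightarrow> (nat \<Rightarrow> real ^ 'd::finite) \<Rightarrow> nat set set" where
  "geometric_edges \<sigma> r n x =
     {{i, j} | i j. i \<in> {1..n} \<and> j \<in> {1..n} \<and> i \<noteq> j \<and> torus_dist \<sigma> (x i) (x j) \<le> r}"

definition geometric_graph ::
    "'d::finite itself \<Rightarrow> ereal \<Rightarrow> real \<Rightarrow> nat \<Rightarrow> nat set set measure" where
  "geometric_graph _ \<sigma> r n =
     distr (\<Pi>\<^sub>M i\<in>{1..n}. (torus_uniform :: (real ^ 'd) measure)) (count_space UNIV)
       (geometric_edges \<sigma> r n)"

text \<open>Matrix indices start at \<open>0\<close>, so row and column \<open>i\<close> belong to the vertex \<open>Suc i\<close>.\<close>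

definition adjacency_matrix :: "nat \<Rightarrow> nat set set \<Rightarrow> real mat" where
  "adjacency_matrix n E =
     Matrix.mat n n (\<lambda>(i, j). if i \<noteq> j \<and> {Suc i, Suc j} \<in> E then 1 else 0)"

definition permanent :: "'a::comm_semiring_1 mat \<Rightarrow> 'a" where
  "permanent A =
     (if dim_row A = dim_col A
      then \<Sum>p | p permutes {0..<dim_row A}. \<Prod>i = 0..<dim_row A. A $$ (i, p i)
      else 0)"

definition xI_plus :: "nat \<Rightarrow> real mat \<Rightarrow> real poly mat" where
  "xI_plus n A = [:0, 1:] \<cdot>\<^sub>m 1\<^sub>m n + map_mat (\<lambda>a. [:a:]) A"

text \<open>Only meaningful if almost all coefficients have expectation \<open>0\<close>, in particular if the
  degree of \<open>P\<close> is bounded.\<close>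

definition expected_poly :: "'a measure \<Rightarrow> ('a \<Rightarrow> real poly) \<Rightarrow> real poly" where
  "expected_poly M P = Abs_poly (\<lambda>k. \<integral>\<omega>. coeff (P \<omega>) k \<partial>M)"

definition Lambda_bar :: "(nat \<Rightarrow> nat set set measure) \<Rightarrow> nat \<Rightarrow> real poly" where
  "Lambda_bar G n =
     expected_poly (G n) (\<lambda>E. Determinant.det (xI_plus n (adjacency_matrix n E)))"

definition Gamma_bar :: "(nat \<Rightarrow> nat set set measure) \<Rightarrow> nat \<Rightarrow> real poly" where
  "Gamma_bar G n =
     expected_poly (G n) (\<lambda>E. permanent (xI_plus n (adjacency_matrix n E)))"

definition cycle_edges :: "nat list \<Rightarrow> nat set set" where
  "cycle_edges ys = {{ys ! i, ys ! Suc i} | i. Suc i < length ys} \<union> {{last ys, hd ys}}"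

text \<open>The fixed cycle is \<open>1, 2, \<dots>, q\<close>; by \<open>Theta_erdos_renyi\<close> and \<open>Theta_geometric_graph\<close>
  below, any other choice of distinct vertices gives the same probability.\<close>

definition Theta :: "(nat \<Rightarrow> nat set set measure) \<Rightarrow> nat \<Rightarrow> nat \<Rightarrow> real" where
  "Theta G n q = measure (G n) {E. cycle_edges [1..<Suc q] \<subseteq> E}"

lemma finite_all_edges [simp]: "finite (all_edges n)"
  by (rule finite_subset[of _ "Pow {1..n}"]) (auto simp: all_edges_def)

lemma cycle_edges_map:
  assumes "xs \<noteq> []"
  shows "cycle_edges (map f xs) = (`) f ` cycle_edges xs"
proof -
  have "cycle_edges ys = (\<lambda>i. {ys ! i, ys ! Suc i}) ` {i. Suc i < length ys} \<union> {{last ys, hd ys}}"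
    for ys :: "nat list"
    by (auto simp: cycle_edges_def)
  moreover have "(\<lambda>i. {map f xs ! i, map f xs ! Suc i}) ` {i. Suc i < length xs} =
      (\<lambda>i. {f (xs ! i), f (xs ! Suc i)}) ` {i. Suc i < length xs}"
    by (rule image_cong) auto
  ultimately show ?thesis
    using assms by (simp add: image_Un image_image last_map hd_map)
qed

lemma cycle_edges_subset:
  assumes "distinct ys" "set ys \<subseteq> {1..n}" "2 \<le> length ys"
  shows "cycle_edges ys \<subseteq> all_edges n"
proof -
  have "last ys \<noteq> hd ys"
    using assms by (cases ys; cases "tl ys") (auto split: if_splits)
  moreover have "last ys \<in> set ys" "hd ys \<in> set ys" using assms(3) by (cases ys; auto)+
  moreover have "ys ! i \<noteq> ys ! Suc i" "ys ! i \<in> set ys" "ys ! Suc i \<in> set ys"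
    if "Suc i < length ys" for i
    using that assms(1) by (auto simp: nth_eq_iff_index_eq)
  ultimately show ?thesis using assms(2) unfolding cycle_edges_def all_edges_def by blast
qed

lemma map_nth_upt_Suc: "map (\<lambda>i. ys ! (i - 1)) [1..<Suc (length ys)] = ys"
  by (rule nth_equalityI) (auto simp del: upt_Suc)

lemma prob_erdos_renyi_supset:
  assumes "0 \<le> p" "p \<le> 1" "C \<subseteq> all_edges n"
  shows "measure (erdos_renyi p n) {E. C \<subseteq> E} = p ^ card C"
proof -
  have "measure (erdos_renyi p n) {E. C \<subseteq> E} =
      measure_pmf.prob (Pi_pmf (all_edges n) False (\<lambda>_. bernoulli_pmf p))
        (Pi (all_edges n) (\<lambda>e. if e \<in> C then {True} else UNIV))"
    unfolding erdos_renyi_def measure_map_pmf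
    by (rule arg_cong[where f = "measure_pmf.prob _"]) (use assms(3) in \<open>fastforce split: if_splits\<close>)
  also have "\<dots> = (\<Prod>e\<in>all_edges n. if e \<in> C then p else 1)"
    by (subst measure_Pi_pmf_Pi) (auto intro!: prod.cong simp: measure_pmf_single assms)
  also have "\<dots> = p ^ card C"
    using assms(3) by (simp add: prod.If_cases Int_absorb1)
  finally show ?thesis .
qed

lemma Theta_erdos_renyi:
  assumes "0 \<le> p" "p \<le> 1" "distinct ys" "set ys \<subseteq> {1..n}" "2 \<le> length ys"
  shows "measure (erdos_renyi p n) {E. cycle_edges ys \<subseteq> E} = Theta (erdos_renyi p) n (length ys)"
proof -
  let ?q = "length ys" let ?f = "\<lambda>i. ys ! (i - 1)"
  have q: "?q \<le> n"
    using card_mono[OF _ assms(4)] assms(3) by (simp add: distinct_card)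
  have sub: "cycle_edges [1..<Suc ?q] \<subseteq> all_edges ?q"
    using assms(5) by (intro cycle_edges_subset) auto
  have inj: "inj_on ?f {1..?q}"
    using assms(3) by (auto simp: inj_on_def nth_eq_iff_index_eq)
  have "cycle_edges ys = (`) ?f ` cycle_edges [1..<Suc ?q]"
    using cycle_edges_map[of "[1..<Suc ?q]" ?f] assms(5) unfolding map_nth_upt_Suc by fastforce
  moreover have "inj_on ((`) ?f) (cycle_edges [1..<Suc ?q])"
    by (rule inj_on_subset[OF inj_on_image_Pow[OF inj]]) (use sub in \<open>auto simp: all_edges_def\<close>)
  ultimately have "card (cycle_edges ys) = card (cycle_edges [1..<Suc ?q])"
    by (simp add: card_image)
  moreover have "cycle_edges [1..<Suc ?q] \<subseteq> all_edges n"
    using assms(5) q by (intro cycle_edges_subset) auto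
  ultimately show ?thesis
    using assms by (simp add: Theta_def prob_erdos_renyi_supset cycle_edges_subset)
qed

lemma lnorm_uminus: "lnorm \<sigma> (- v) = lnorm \<sigma> v"
  by (simp add: lnorm_def)

lemma torus_dist_commute: "torus_dist \<sigma> x y = torus_dist \<sigma> y x"
proof -
  let ?Z = "{u::real ^ 'a. \<forall>i. u $ i \<in> \<int>}"
  have sub: "(\<lambda>u. lnorm \<sigma> (x - y - u)) ` ?Z \<subseteq> (\<lambda>u. lnorm \<sigma> (y - x - u)) ` ?Z" for x y :: "real ^ 'a"
  proof
    fix l assume "l \<in> (\<lambda>u. lnorm \<sigma> (x - y - u)) ` ?Z"
    then obtain u where u: "u \<in> ?Z" "l = lnorm \<sigma> (x - y - u)" by blast
    have "- u \<in> ?Z" using u(1) by simp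
    moreover have "- (x - y - u) = y - x - (- u)" by simp
    then have "l = lnorm \<sigma> (y - x - (- u))" using lnorm_uminus u(2) by metis
    ultimately show "l \<in> (\<lambda>u. lnorm \<sigma> (y - x - u)) ` ?Z" by (rule rev_image_eqI)
  qed
  show ?thesis unfolding torus_dist_def by (rule arg_cong[OF equalityI[OF sub sub]])
qed

lemma doubleton_in_geometric_edges:
  "{i, j} \<in> geometric_edges \<sigma> r n x \<longleftrightarrow>
     i \<in> {1..n} \<and> j \<in> {1..n} \<and> i \<noteq> j \<and> torus_dist \<sigma> (x i) (x j) \<le> r"
  unfolding geometric_edges_def by (auto simp: doubleton_eq_iff torus_dist_commute)

lemma sets_torus_uniform [measurable_cong, simp]: "sets torus_uniform = sets borel"
  by (simp add: torus_uniform_def)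

lemma prob_space_torus_uniform: "prob_space (torus_uniform :: (real ^ 'd::finite) measure)"
proof -
  let ?C = "{x::real ^ 'd. \<forall>i. 0 \<le> x $ i \<and> x $ i < 1}"
  have "?C \<in> sets borel" by measurable
  moreover have "box 0 1 \<subseteq> ?C" "?C \<subseteq> cbox 0 (1 :: real ^ 'd)"
    by (auto simp: mem_box_cart less_imp_le)
  ultimately have "emeasure lborel (box 0 (1 :: real ^ 'd)) \<le> emeasure lborel ?C"
      "emeasure lborel ?C \<le> emeasure lborel (cbox 0 (1 :: real ^ 'd))"
    by (auto intro!: emeasure_mono)
  moreover have "emeasure lborel (box 0 (1 :: real ^ 'd)) = 1" "emeasure lborel (cbox 0 (1 :: real ^ 'd)) = 1"
    by (auto simp: emeasure_lborel_box_eq emeasure_lborel_cbox_eq Basis_vec_def inner_axis prod.neutral)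
  ultimately have "emeasure lborel ?C = 1" by simp
  then show ?thesis unfolding torus_uniform_def
    by (intro prob_space_uniform_measure) auto
qed

lemma borel_measurable_lnorm [measurable]: "lnorm \<sigma> \<in> borel_measurable borel"
  unfolding lnorm_def by measurable

lemma countable_int_vectors: "countable {u :: real ^ 'd::finite. \<forall>i. u $ i \<in> \<int>}"
proof -
  have "{u :: real ^ 'd. \<forall>i. u $ i \<in> \<int>} \<subseteq> vec_lambda ` (PiE UNIV (\<lambda>_. \<int>))"
    by (auto simp: image_iff PiE_UNIV_domain Pi_iff intro!: bexI[of _ "vec_nth u" for u])
  moreover have "countable (PiE (UNIV :: 'd set) (\<lambda>_. \<int> :: real set))"
    by (intro countable_PiE) (auto simp: Ints_def)
  ultimately show ?thesis by (meson countable_image countable_subset)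
qed

lemma lnorm_nonneg: "0 \<le> lnorm \<sigma> v"
  by (auto simp: lnorm_def Max_ge_iff)

lemma borel_measurable_torus_dist [measurable]:
  fixes f g :: "'a \<Rightarrow> real ^ 'd::finite"
  assumes [measurable]: "f \<in> borel_measurable M" "g \<in> borel_measurable M"
  shows "(\<lambda>w. torus_dist \<sigma> (f w) (g w)) \<in> borel_measurable M"
  unfolding torus_dist_def
  by (rule borel_measurable_cINF[OF countable_int_vectors])
     (auto intro!: bdd_belowI[of _ 0] lnorm_nonneg)

lemma geometric_edges_measurable [measurable]:
  "geometric_edges \<sigma> r n \<in>
     (\<Pi>\<^sub>M i\<in>{1..n}. (torus_uniform :: (real ^ 'd::finite) measure)) \<rightarrow>\<^sub>M count_space UNIV"
  (is "_ \<in> ?M \<rightarrow>\<^sub>M _")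
proof -
  have fin: "geometric_edges \<sigma> r n x \<in> Pow (Pow {1..n})" for x :: "nat \<Rightarrow> real ^ 'd"
    by (auto simp: geometric_edges_def)
  have "geometric_edges \<sigma> r n -` {E} \<inter> space ?M \<in> sets ?M" for E
  proof -
    let ?D = "\<lambda>i j. {x \<in> space ?M. {i, j} \<in> geometric_edges \<sigma> r n x}"
    have D [measurable]: "?D i j \<in> sets ?M" for i j
    proof (cases "i \<in> {1..n} \<and> j \<in> {1..n}")
      case True
      then have [measurable]: "(\<lambda>x. x i) \<in> borel_measurable ?M" "(\<lambda>x. x j) \<in> borel_measurable ?M"
        using measurable_component_singleton[of _ "{1..n}" "\<lambda>_. torus_uniform :: (real ^ 'd) measure"]
        by (auto simp: measurable_cong_sets[OF refl sets_torus_uniform])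
      show ?thesis unfolding doubleton_in_geometric_edges by measurable
    qed (auto simp: doubleton_in_geometric_edges)
    show ?thesis
    proof (cases "E \<subseteq> all_edges n")
      case True
      have "geometric_edges \<sigma> r n x = E \<longleftrightarrow>
          (\<forall>i\<in>{1..n}. \<forall>j\<in>{1..n}. ({i, j} \<in> geometric_edges \<sigma> r n x) = ({i, j} \<in> E))"
        for x :: "nat \<Rightarrow> real ^ 'd"
      proof
        assume *: "\<forall>i\<in>{1..n}. \<forall>j\<in>{1..n}. ({i, j} \<in> geometric_edges \<sigma> r n x) = ({i, j} \<in> E)"
        show "geometric_edges \<sigma> r n x = E"
        proof (intro equalityI subsetI)
          fix e assume e: "e \<in> geometric_edges \<sigma> r n x"
          then obtain i j where "e = {i, j}" "i \<in> {1..n}" "j \<in> {1..n}"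
            unfolding geometric_edges_def by blast
          with * e show "e \<in> E" by blast
        next
          fix e assume e: "e \<in> E"
          then obtain i j where "e = {i, j}" "i \<in> {1..n}" "j \<in> {1..n}"
            using True unfolding all_edges_def by blast
          with * e show "e \<in> geometric_edges \<sigma> r n x" by blast
        qed
      qed auto
      then have "geometric_edges \<sigma> r n -` {E} \<inter> space ?M =
          {x \<in> space ?M.
            \<forall>i\<in>{1..n}. \<forall>j\<in>{1..n}. ({i, j} \<in> geometric_edges \<sigma> r n x) = ({i, j} \<in> E)}"
        by auto
      also have "\<dots> \<in> sets ?M" by measurable
      finally show ?thesis .
    next
      case False
      then have "(geometric_edges \<sigma> r n :: (nat \<Rightarrow> real ^ 'd) \<Rightarrow> _) -` {E} = {}"
        by (auto simp: geometric_edges_def all_edges_def)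
      then show ?thesis by (simp only: Int_empty_left sets.empty_sets)
    qed
  qed
  then have "geometric_edges \<sigma> r n \<in> ?M \<rightarrow>\<^sub>M count_space (Pow (Pow {1..n}))"
    by (subst measurable_count_space_eq2) (use fin in auto)
  from measurable_compose[OF this, of "\<lambda>x. x" "count_space UNIV"] show ?thesis by simp
qed

lemma Theta_geometric_graph:
  assumes "distinct ys" "set ys \<subseteq> {1..n}" "2 \<le> length ys"
  shows "measure (geometric_graph TYPE('d::finite) \<sigma> r n) {E. cycle_edges ys \<subseteq> E} =
    Theta (geometric_graph TYPE('d) \<sigma> r) n (length ys)"
proof -
  let ?U = "torus_uniform :: (real ^ 'd) measure"
  let ?q = "length ys"
  let ?C = "cycle_edges [1..<Suc ?q]"
  let ?P = "\<lambda>m. \<Pi>\<^sub>M i\<in>{1..m}. ?U"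
  have sub: "?C \<subseteq> all_edges ?q"
    using assms(3) by (intro cycle_edges_subset) auto
  have q: "?q \<le> n"
    using card_mono[OF _ assms(2)] assms(1) by (simp add: distinct_card)
  have main: "measure (geometric_graph TYPE('d) \<sigma> r n) {E. (`) f ` ?C \<subseteq> E} =
      measure (?P ?q) {x \<in> space (?P ?q). ?C \<subseteq> geometric_edges \<sigma> r ?q x}"
    if inj: "inj_on f {1..?q}" and f: "f \<in> {1..?q} \<rightarrow> {1..n}" for f
  proof -
    let ?t = "\<lambda>w. \<lambda>i\<in>{1..?q}. w (f i)"
    have distr: "distr (?P n) (?P ?q) ?t = ?P ?q"
      using distr_PiM_reindex[of "{1..n}" "\<lambda>_. ?U" f "{1..?q}"] inj f prob_space_torus_uniform by simp
    have t: "?t \<in> ?P n \<rightarrow>\<^sub>M ?P ?q"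
      using f by (intro measurable_restrict measurable_component_singleton) auto
    have ev: "(`) f ` ?C \<subseteq> geometric_edges \<sigma> r n w \<longleftrightarrow> ?C \<subseteq> geometric_edges \<sigma> r ?q (?t w)"
      for w :: "nat \<Rightarrow> real ^ 'd"
    proof -
      have "f ` e \<in> geometric_edges \<sigma> r n w \<longleftrightarrow> e \<in> geometric_edges \<sigma> r ?q (?t w)" if eC: "e \<in> ?C" for e
      proof -
        obtain i j where e: "e = {i, j}" "i \<in> {1..?q}" "j \<in> {1..?q}" "i \<noteq> j"
          using eC sub unfolding all_edges_def by blast
        moreover have "f i \<noteq> f j" using e inj_on_eq_iff[OF inj, of i j] by blast
        moreover have "f i \<in> {1..n}" "f j \<in> {1..n}" using e f by auto
        ultimately show ?thesis by (simp add: doubleton_in_geometric_edges)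
      qed
      then show ?thesis by (auto simp only: image_subset_iff subset_iff)
    qed
    have "measure (geometric_graph TYPE('d) \<sigma> r n) {E. (`) f ` ?C \<subseteq> E} =
        measure (?P n) {w \<in> space (?P n). (`) f ` ?C \<subseteq> geometric_edges \<sigma> r n w}"
      unfolding geometric_graph_def
      by (subst measure_distr[OF geometric_edges_measurable]) (auto intro!: arg_cong[where f = "measure _"])
    also have "\<dots> = measure (?P n)
        (?t -` {x \<in> space (?P ?q). ?C \<subseteq> geometric_edges \<sigma> r ?q x} \<inter> space (?P n))"
      unfolding ev using measurable_space[OF t] by (intro arg_cong[where f = "measure _"]) auto
    also have "\<dots> = measure (distr (?P n) (?P ?q) ?t)
        {x \<in> space (?P ?q). ?C \<subseteq> geometric_edges \<sigma> r ?q x}"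
      by (rule measure_distr[symmetric, OF t]) measurable
    finally show ?thesis unfolding distr .
  qed
  let ?f = "\<lambda>i. ys ! (i - 1)"
  have "cycle_edges ys = (`) ?f ` ?C"
    using cycle_edges_map[of "[1..<Suc ?q]" ?f] assms(3) unfolding map_nth_upt_Suc by fastforce
  moreover have "inj_on ?f {1..?q}"
    using assms(1) by (auto simp: inj_on_def nth_eq_iff_index_eq)
  moreover have "?f \<in> {1..?q} \<rightarrow> {1..n}"
    using assms(2) by (auto simp: subset_iff in_set_conv_nth) (metis Suc_le_eq Suc_pred)+
  moreover have "measure (geometric_graph TYPE('d) \<sigma> r n) {E. ?C \<subseteq> E} =
      measure (?P ?q) {x \<in> space (?P ?q). ?C \<subseteq> geometric_edges \<sigma> r ?q x}"
    using main[of "\<lambda>i. i"] q by simp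
  ultimately show ?thesis using main[of ?f] unfolding Theta_def by simp
qed

end

theory Submission
  imports Defs
begin

text \<open>Fix a vertex \<open>a\<close> and classify the permutations in the expansion of the determinant or the
  permanent by their cycle through \<open>a\<close>. Each of the \<open>(n - 1)! / (n - q)!\<close> cycles of length \<open>q \<ge> 2\<close>
  carries the sign \<open>(- 1) ^ (q - 1)\<close> and is present with probability \<open>\<Theta>\<close>, independently of the edges
  among the remaining \<open>n - q\<close> vertices, which form a copy of the smaller graph; a fixed point
  contributes the factor \<open>x\<close>. The cycle through \<open>a\<close> is uncovered one vertex at a time, by contracting
  the successor of \<open>a\<close>. Of the random graph, only independence over disjoint vertex sets and the
  cycle probabilities matter.\<close>

section \<open>Contracting the cycle through a vertex\<close>

text \<open>With \<open>\<epsilon>\<close> equal to -1 this is a determinant and with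
  \<open>\<epsilon>\<close> equal to 1 a permanent, so one argument serves both recurrences. The
  index set is arbitrary, so that vertices can be removed without renumbering.\<close>

definition signed_perm_sum :: "'a::comm_ring_1 \<Rightarrow> (nat \<Rightarrow> nat \<Rightarrow> 'a) \<Rightarrow> nat set \<Rightarrow> 'a" where
  "signed_perm_sum \<epsilon> B S =
     (\<Sum>p | p permutes S. (if evenperm p then 1 else \<epsilon>) * (\<Prod>i\<in>S. B i (p i)))"

lemma signed_perm_sum_empty [simp]: "signed_perm_sum \<epsilon> B {} = 1"
proof -
  have "{p. p permutes ({} :: nat set)} = {id}" by (auto simp: permutes_empty)
  then show ?thesis by (simp add: signed_perm_sum_def)
qed

text \<open>Composing with the transposition of \<open>a\<close> and \<open>b = p a\<close> contracts \<open>b\<close> out of the cycle of \<open>p\<close>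
  through \<open>a\<close>.\<close>

lemma bij_betw_contract_permutation:
  assumes "a \<in> S" "b \<in> S"
  shows "bij_betw (\<lambda>q. q \<circ> Transposition.transpose a b) {q. q permutes (S - {b})} {p. p permutes S \<and> p a = b}"
proof (rule bij_betw_byWitness[where f' = "\<lambda>p. p \<circ> Transposition.transpose a b"])
  show "(\<lambda>q. q \<circ> Transposition.transpose a b) ` {q. q permutes (S - {b})} \<subseteq> {p. p permutes S \<and> p a = b}"
  proof clarify
    fix q assume q: "q permutes (S - {b})"
    then have "q permutes S" using permutes_subset by blast
    moreover have "q b = b" using q by (simp add: permutes_not_in)
    ultimately show "q \<circ> Transposition.transpose a b permutes S \<and> (q \<circ> Transposition.transpose a b) a = b"
      using assms by (simp add: permutes_compose permutes_swap_id)
  qed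
  show "(\<lambda>p. p \<circ> Transposition.transpose a b) ` {p. p permutes S \<and> p a = b} \<subseteq> {q. q permutes (S - {b})}"
  proof (rule image_subsetI)
    fix p assume "p \<in> {p. p permutes S \<and> p a = b}"
    then have p: "p permutes S" "p a = b" by auto
    have "p \<circ> Transposition.transpose a b permutes S"
      using p assms by (simp add: permutes_compose permutes_swap_id)
    then have "p \<circ> Transposition.transpose a b permutes (S - {b})"
      by (rule permutes_superset) (use p in auto)
    then show "p \<circ> Transposition.transpose a b \<in> {q. q permutes (S - {b})}" by simp
  qed
qed (simp_all add: comp_assoc)

text \<open>Replacing row \<open>a\<close> by row \<open>c\<close> models a cycle through \<open>a\<close> whose initial part, from \<open>a\<close> to \<open>c\<close>,
  has already been contracted.\<close>

lemma signed_perm_sum_contract: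
  fixes B :: "nat \<Rightarrow> nat \<Rightarrow> 'a::comm_ring_1"
  assumes "finite S" "a \<in> S" "\<epsilon> * \<epsilon> = 1"
  shows "signed_perm_sum \<epsilon> (B(a := B c)) S =
    B c a * signed_perm_sum \<epsilon> B (S - {a}) +
    \<epsilon> * (\<Sum>b\<in>S - {a}. B c b * signed_perm_sum \<epsilon> (B(a := B b)) (S - {b}))"
proof -
  let ?s = "\<lambda>p. if evenperm p then 1 else \<epsilon>"
  let ?f = "\<lambda>p. ?s p * (\<Prod>i\<in>S. (B(a := B c)) i (p i))"
  have fin: "finite {p. p permutes S}" using assms(1) by (rule finite_permutations)
  have "signed_perm_sum \<epsilon> (B(a := B c)) S = (\<Sum>b\<in>S. \<Sum>p | p permutes S \<and> p a = b. ?f p)"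
    unfolding signed_perm_sum_def
    by (subst sum.group[OF fin assms(1), of "\<lambda>p. p a", symmetric])
       (use assms in \<open>auto simp: permutes_in_image\<close>)
  also have "\<dots> = (\<Sum>b\<in>S. \<Sum>q | q permutes (S - {b}). ?f (q \<circ> Transposition.transpose a b))"
    by (intro sum.cong refl sum.reindex_bij_betw[symmetric] bij_betw_contract_permutation assms)
  \<comment> \<open>For \<open>b = a\<close> the cycle closes: the transposition is the identity, so
    this summand keeps its sign and is split off. Every other transposition is odd and costs a
    factor \<open>\<epsilon>\<close>.\<close>
  also have "\<dots> = (\<Sum>q | q permutes (S - {a}). ?f q)
      + (\<Sum>b\<in>S - {a}. \<Sum>q | q permutes (S - {b}). ?f (q \<circ> Transposition.transpose a b))"
    by (subst sum.remove[OF assms(1,2)]) simp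
  also have "(\<Sum>q | q permutes (S - {a}). ?f q) = B c a * signed_perm_sum \<epsilon> B (S - {a})"
    unfolding signed_perm_sum_def sum_distrib_left
  proof (rule sum.cong[OF refl], clarify)
    fix q assume q: "q permutes (S - {a})"
    then have "q a = a" by (simp add: permutes_not_in)
    then show "?f q = B c a * (?s q * (\<Prod>i\<in>S - {a}. B i (q i)))"
      by (subst prod.remove[OF assms(1,2)]) (simp add: algebra_simps)
  qed
  also have "(\<Sum>b\<in>S - {a}. \<Sum>q | q permutes (S - {b}). ?f (q \<circ> Transposition.transpose a b)) =
      \<epsilon> * (\<Sum>b\<in>S - {a}. B c b * signed_perm_sum \<epsilon> (B(a := B b)) (S - {b}))"
    unfolding signed_perm_sum_def sum_distrib_left
  proof (intro sum.cong[OF refl])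
    fix b q assume "b \<in> S - {a}" "q \<in> {q. q permutes (S - {b})}"
    then have b: "b \<in> S" "b \<noteq> a" and q: "q permutes (S - {b})" by auto
    have qb: "q b = b" using q by (simp add: permutes_not_in)
    have "permutation q" using q assms(1) permutation_permutes by blast
    then have "evenperm (q \<circ> Transposition.transpose a b) \<longleftrightarrow> \<not> evenperm q"
      using b(2) by (simp add: evenperm_comp permutation_swap_id evenperm_swap)
    then have "?s (q \<circ> Transposition.transpose a b) = \<epsilon> * ?s q"
      using assms(3) by simp
    \<comment> \<open>At index \<open>a\<close> the composite takes the value
      \<open>q b = b\<close>, which leaves the factor \<open>B c b\<close>. At index
      \<open>b\<close> it takes the value \<open>q a\<close>, and this entry of row \<open>b\<close>
      is the one that the updated matrix holds at index \<open>a\<close>.\<close>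
    moreover have "(\<Prod>i\<in>S. (B(a := B c)) i ((q \<circ> Transposition.transpose a b) i)) =
        B c b * (\<Prod>i\<in>S - {b}. (B(a := B b)) i (q i))"
    proof -
      have a: "a \<in> S - {b}" and b': "b \<in> S - {a}" using b assms(2) by auto
      let ?g = "\<lambda>i. (B(a := B c)) i ((q \<circ> Transposition.transpose a b) i)"
      have "prod ?g S = ?g a * (?g b * prod ?g (S - {a} - {b}))"
        using prod.remove[OF assms(1,2), of ?g] prod.remove[OF _ b', of ?g] assms(1) by simp
      also have "S - {a} - {b} = S - {b} - {a}" by auto
      also have "prod ?g (S - {b} - {a}) = (\<Prod>i\<in>S - {b} - {a}. (B(a := B b)) i (q i))"
        by (intro prod.cong refl) auto
      also have "?g a = B c b" using qb by simp
      also have "?g b = (B(a := B b)) a (q a)" using b(2) by simp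
      also have "(B(a := B b)) a (q a) * (\<Prod>i\<in>S - {b} - {a}. (B(a := B b)) i (q i)) =
          (\<Prod>i\<in>S - {b}. (B(a := B b)) i (q i))"
        by (rule prod.remove[symmetric]) (use a assms(1) in auto)
      finally show ?thesis .
    qed
    ultimately show "?f (q \<circ> Transposition.transpose a b) =
        \<epsilon> * (B c b * (?s q * (\<Prod>i\<in>S - {b}. (B(a := B b)) i (q i))))"
      by (simp only: mult_ac)
  qed
  finally show ?thesis .
qed

section \<open>Determinant and permanent of a graph as permutation sums\<close>

definition edge_weight :: "nat set set \<Rightarrow> nat \<Rightarrow> nat \<Rightarrow> real poly" where
  "edge_weight E i j = (if i = j then [:0, 1:] else of_bool ({Suc i, Suc j} \<in> E))"

lemma prod_of_bool:
  "finite A \<Longrightarrow> (\<Prod>i\<in>A. of_bool (P i)) = (of_bool (\<forall>i\<in>A. P i) :: 'a::comm_semiring_1)"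
  by (induction A rule: finite_induct) auto

text \<open>A graph enters each permutation term only through the inclusion of one fixed edge set,
  so expectations of such terms reduce to probabilities of inclusions. A 2-cycle meets its edge
  twice, but the square of an indicator is the indicator, so the edge counts once.\<close>

lemma prod_edge_weight:
  assumes "finite S"
  shows "(\<Prod>i\<in>S. edge_weight E i (p i)) =
    [:0, 1:] ^ card {i \<in> S. p i = i} * of_bool ((\<lambda>i. {Suc i, Suc (p i)}) ` {i \<in> S. p i \<noteq> i} \<subseteq> E)"
proof -
  have "(\<Prod>i\<in>S. edge_weight E i (p i)) =
      (\<Prod>i\<in>S. if p i = i then [:0, 1:] else of_bool ({Suc i, Suc (p i)} \<in> E))"
    by (intro prod.cong refl) (auto simp: edge_weight_def)
  also have "\<dots> = [:0, 1:] ^ card (S \<inter> {i. p i = i}) *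
      (\<Prod>i\<in>S \<inter> - {i. p i = i}. of_bool ({Suc i, Suc (p i)} \<in> E))"
    unfolding prod.If_cases[OF assms] prod_constant ..
  also have "(\<Prod>i\<in>S \<inter> - {i. p i = i}. of_bool ({Suc i, Suc (p i)} \<in> E)) =
      (of_bool (\<forall>i\<in>S \<inter> - {i. p i = i}. {Suc i, Suc (p i)} \<in> E) :: real poly)"
    using assms by (intro prod_of_bool) auto
  also have "(\<forall>i\<in>S \<inter> - {i. p i = i}. {Suc i, Suc (p i)} \<in> E) \<longleftrightarrow>
      (\<lambda>i. {Suc i, Suc (p i)}) ` {i \<in> S. p i \<noteq> i} \<subseteq> E"
    by blast
  also have "S \<inter> {i. p i = i} = {i \<in> S. p i = i}" by blast
  finally show ?thesis .
qed

text \<open>The right-hand side is free of \<open>n\<close>: one weight function on all indices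
  serves every vertex set and every graph size.\<close>

lemma xI_plus_adjacency_matrix:
  assumes "i < n" "j < n"
  shows "xI_plus n (adjacency_matrix n E) $$ (i, j) = edge_weight E i j"
  using assms by (auto simp: xI_plus_def adjacency_matrix_def edge_weight_def pCons_one)

lemma dim_xI_plus_adjacency_matrix [simp]:
  "dim_row (xI_plus n (adjacency_matrix n E)) = n" "dim_col (xI_plus n (adjacency_matrix n E)) = n"
  by (simp_all add: xI_plus_def adjacency_matrix_def)

lemma prod_xI_plus_adjacency_matrix:
  assumes "p permutes {0..<n}"
  shows "(\<Prod>i = 0..<n. xI_plus n (adjacency_matrix n E) $$ (i, p i)) =
    (\<Prod>i = 0..<n. edge_weight E i (p i))"
proof (rule prod.cong[OF refl])
  fix i assume "i \<in> {0..<n}"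
  moreover from this have "p i \<in> {0..<n}" using permutes_in_image[OF assms] by blast
  ultimately show "xI_plus n (adjacency_matrix n E) $$ (i, p i) = edge_weight E i (p i)"
    by (simp add: xI_plus_adjacency_matrix)
qed

lemma det_xI_plus:
  "Determinant.det (xI_plus n (adjacency_matrix n E)) =
     signed_perm_sum (- 1) (edge_weight E) {0..<n}"
  unfolding Determinant.det_def signed_perm_sum_def
  unfolding dim_xI_plus_adjacency_matrix if_P[OF refl]
proof (rule sum.cong[OF refl])
  fix p assume "p \<in> {p. p permutes {0..<n}}"
  then show "of_int (sign p) * (\<Prod>i = 0..<n. xI_plus n (adjacency_matrix n E) $$ (i, p i)) =
      (if evenperm p then 1 else - 1) * (\<Prod>i = 0..<n. edge_weight E i (p i))"
    by (simp add: prod_xI_plus_adjacency_matrix sign_def)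
qed

lemma permanent_xI_plus:
  "permanent (xI_plus n (adjacency_matrix n E)) = signed_perm_sum 1 (edge_weight E) {0..<n}"
  unfolding permanent_def signed_perm_sum_def dim_xI_plus_adjacency_matrix if_P[OF refl]
  by (rule sum.cong) (simp_all add: prod_xI_plus_adjacency_matrix)

section \<open>Expected permutation sums\<close>

definition edges_on :: "nat set \<Rightarrow> nat set set" where
  "edges_on V = {{i, j} | i j. i \<in> V \<and> j \<in> V \<and> i \<noteq> j}"

lemma all_edges_eq_edges_on: "all_edges n = edges_on {1..n}"
  by (simp add: all_edges_def edges_on_def)

lemma edges_on_mono: "V \<subseteq> W \<Longrightarrow> edges_on V \<subseteq> edges_on W"
  unfolding edges_on_def by blast

text \<open>A cycle without its closing edge, that is, the part of the cycle uncovered so far.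
  Uncovering another vertex adds one edge at the end.\<close>

definition path_edges :: "nat list \<Rightarrow> nat set set" where
  "path_edges ys = {{ys ! i, ys ! Suc i} | i. Suc i < length ys}"

lemma cycle_edges_eq_path_edges: "cycle_edges ys = insert {last ys, hd ys} (path_edges ys)"
  by (simp add: cycle_edges_def path_edges_def)

lemma path_edges_singleton [simp]: "path_edges [y] = {}"
  by (simp add: path_edges_def)

lemma path_edges_snoc:
  assumes "ys \<noteq> []"
  shows "path_edges (ys @ [b]) = insert {last ys, b} (path_edges ys)"
proof -
  have eq: "path_edges zs = (\<lambda>i. {zs ! i, zs ! Suc i}) ` {i. Suc i < length zs}" for zs
    by (auto simp: path_edges_def)
  have "{i. Suc i < length (ys @ [b])} = insert (length ys - 1) {i. Suc i < length ys}"
    using assms by (cases ys) auto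
  moreover have "(\<lambda>i. {(ys @ [b]) ! i, (ys @ [b]) ! Suc i}) ` {i. Suc i < length ys} =
      (\<lambda>i. {ys ! i, ys ! Suc i}) ` {i. Suc i < length ys}"
    by (rule image_cong) (auto simp: nth_append)
  moreover have "{(ys @ [b]) ! (length ys - 1), (ys @ [b]) ! Suc (length ys - 1)} = {last ys, b}"
    using assms by (simp add: nth_append last_conv_nth)
  ultimately show ?thesis unfolding eq by simp
qed

lemma cycle_edges_subset_edges_on:
  assumes "distinct ys" "2 \<le> length ys"
  shows "cycle_edges ys \<subseteq> edges_on (set ys)"
proof -
  have "last ys \<noteq> hd ys"
    using assms by (cases ys; cases "tl ys") (auto split: if_splits)
  moreover have "last ys \<in> set ys" "hd ys \<in> set ys" using assms(2) by (cases ys; auto)+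
  moreover have "ys ! i \<noteq> ys ! Suc i" "ys ! i \<in> set ys" "ys ! Suc i \<in> set ys"
    if "Suc i < length ys" for i
    using that assms(1) by (auto simp: nth_eq_iff_index_eq)
  ultimately show ?thesis unfolding cycle_edges_def edges_on_def by blast
qed

lemma permutation_edges_subset:
  assumes "p permutes S"
  shows "(\<lambda>i. {Suc i, Suc (p i)}) ` {i \<in> S. p i \<noteq> i} \<subseteq> edges_on (Suc ` S)"
proof clarify
  fix i assume "i \<in> S" "p i \<noteq> i"
  moreover from this have "p i \<in> S" using permutes_in_image[OF assms] by blast
  ultimately have "Suc i \<in> Suc ` S \<and> Suc (p i) \<in> Suc ` S \<and> Suc i \<noteq> Suc (p i)" by auto
  then show "{Suc i, Suc (p i)} \<in> edges_on (Suc ` S)" unfolding edges_on_def by blast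
qed

lemma smult_sum_right: "Polynomial.smult c (\<Sum>i\<in>I. f i) = (\<Sum>i\<in>I. Polynomial.smult c (f i))"
  by (induction I rule: infinite_finite_induct) (simp_all add: smult_add_right)

text \<open>The properties of a model on which the recurrence rests. Independence is required only
  between edges on disjoint vertex sets, since in the geometric model the edges of a triangle are in
  general dependent. \<open>Theta_stable\<close> makes cycle probabilities comparable between graphs
  of different sizes.\<close>

locale random_graph_family =
  fixes G :: "nat \<Rightarrow> nat set set measure"
  assumes prob_space_graph: "prob_space (G n)"
    and sets_graph: "sets (G n) = UNIV"
    and AE_edges: "AE E in G n. E \<subseteq> all_edges n"
    and prob_cycle: "distinct ys \<Longrightarrow> set ys \<subseteq> {1..n} \<Longrightarrow> 2 \<le> length ys \<Longrightarrow>
      measure (G n) {E. cycle_edges ys \<subseteq> E} = Theta G n (length ys)"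
    and Theta_stable: "2 \<le> q \<Longrightarrow> q \<le> n \<Longrightarrow> Theta G n q = Theta G q q"
    and indep_edges: "V \<subseteq> {1..n} \<Longrightarrow> W \<subseteq> {1..n} \<Longrightarrow> V \<inter> W = {} \<Longrightarrow>
      C \<subseteq> edges_on V \<Longrightarrow> D \<subseteq> edges_on W \<Longrightarrow>
      measure (G n) {E. C \<union> D \<subseteq> E} = measure (G n) {E. C \<subseteq> E} * measure (G n) {E. D \<subseteq> E}"
begin

section \<open>Expectations over the graph as finite sums\<close>

lemma space_graph: "space (G n) = UNIV"
  using sets_eq_imp_space_eq[of "G n" "count_space UNIV"] sets_graph by simp

lemma measurable_graph: "f \<in> borel_measurable (G n)"
  by (simp add: measurable_def sets_graph space_graph)

text \<open>Almost every graph is a subset of the finite set \<open>all_edges n\<close>, so the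
  integrand agrees almost everywhere with a finite combination of indicators.\<close>

lemma integral_graph:
  fixes f :: "nat set set \<Rightarrow> real"
  shows "(\<integral>E. f E \<partial>G n) = (\<Sum>E\<in>Pow (all_edges n). measure (G n) {E} * f E)"
proof -
  interpret prob_space "G n" by (rule prob_space_graph)
  have "(\<integral>E. f E \<partial>G n) = (\<integral>E. (\<Sum>F\<in>Pow (all_edges n). f F * indicator {F} E) \<partial>G n)"
  proof (rule integral_cong_AE[OF measurable_graph measurable_graph])
    show "AE E in G n. f E = (\<Sum>F\<in>Pow (all_edges n). f F * indicator {F} E)"
      using AE_edges[of n]
    proof eventually_elim
      case (elim E)
      then have "(\<Sum>F\<in>Pow (all_edges n). f F * indicator {F} E) =
          (\<Sum>F\<in>{E}. f F * indicator {F} E)"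
        by (intro sum.mono_neutral_right) (auto simp: indicator_def)
      then show ?case by simp
    qed
  qed
  also have "\<dots> = (\<Sum>F\<in>Pow (all_edges n). \<integral>E. f F * indicator {F} E \<partial>G n)"
    by (rule Bochner_Integration.integral_sum) (simp add: sets_graph less_top[symmetric])
  also have "\<dots> = (\<Sum>E\<in>Pow (all_edges n). measure (G n) {E} * f E)"
    by (simp add: sets_graph space_graph mult.commute)
  finally show ?thesis .
qed

text \<open>In this form linearity, even over constant factors that are themselves polynomials,
  follows from the rules for finite sums.\<close>

definition graph_expectation :: "nat \<Rightarrow> (nat set set \<Rightarrow> real poly) \<Rightarrow> real poly" where
  "graph_expectation n f = (\<Sum>E\<in>Pow (all_edges n). Polynomial.smult (measure (G n) {E}) (f E))"

text \<open>By the finite sum for integrals, the expected coefficients are the coefficients of an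
  actual polynomial, so \<open>Abs_poly\<close> returns that polynomial.\<close>

lemma expected_poly_graph: "expected_poly (G n) f = graph_expectation n f"
  by (simp add: expected_poly_def integral_graph graph_expectation_def coeff_sum[symmetric]
      coeff_smult[symmetric] coeff_inverse del: coeff_smult)

lemma graph_expectation_add:
  "graph_expectation n (\<lambda>E. f E + g E) = graph_expectation n f + graph_expectation n g"
  by (simp add: graph_expectation_def smult_add_right sum.distrib)

lemma graph_expectation_mult_const:
  "graph_expectation n (\<lambda>E. c * f E) = c * graph_expectation n f"
  by (simp add: graph_expectation_def sum_distrib_left)

lemma graph_expectation_sum:
  "graph_expectation n (\<lambda>E. \<Sum>i\<in>I. f i E) = (\<Sum>i\<in>I. graph_expectation n (f i))"
  unfolding graph_expectation_def smult_sum_right by (rule sum.swap)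

lemma graph_expectation_supset:
  "graph_expectation n (\<lambda>E. of_bool (C \<subseteq> E)) = [:measure (G n) {E. C \<subseteq> E}:]"
proof -
  have "measure (G n) {E. C \<subseteq> E} = (\<integral>E. indicator {E. C \<subseteq> E} E \<partial>G n)"
    by (simp add: space_graph sets_graph)
  also have "\<dots> = (\<Sum>E\<in>Pow (all_edges n). measure (G n) {E} * of_bool (C \<subseteq> E))"
    unfolding integral_graph by (simp add: indicator_def of_bool_def)
  finally have eq: "measure (G n) {E. C \<subseteq> E} = \<dots>" .
  have "Polynomial.smult m (of_bool b) = [:m * of_bool b:]" for m :: real and b by simp
  moreover have "(\<Sum>i\<in>I. [:f i:]) = [:\<Sum>i\<in>I. f i:]" for I :: "nat set set set" and f :: "_ \<Rightarrow> real"
    by (induction I rule: infinite_finite_induct) simp_all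
  ultimately show ?thesis unfolding graph_expectation_def eq by (simp only:)
qed

lemma graph_expectation_indep:
  assumes "V \<subseteq> {1..n}" "Suc ` S \<subseteq> {1..n}" "V \<inter> Suc ` S = {}" "C \<subseteq> edges_on V"
  shows "graph_expectation n (\<lambda>E. of_bool (C \<subseteq> E) * signed_perm_sum \<epsilon> (edge_weight E) S) =
    Polynomial.smult (measure (G n) {E. C \<subseteq> E})
      (graph_expectation n (\<lambda>E. signed_perm_sum \<epsilon> (edge_weight E) S))"
proof -
  have "finite (Suc ` S)" using assms(2) finite_subset by blast
  then have fin: "finite S" by (simp add: finite_image_iff)
  define w where "w = (\<lambda>p. (if evenperm p then 1 else \<epsilon>) * [:0, 1:] ^ card {i \<in> S. p i = i})"
  define D where "D = (\<lambda>p. (\<lambda>i. {Suc i, Suc (p i)}) ` {i \<in> S. p i \<noteq> i})"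
  have sps: "signed_perm_sum \<epsilon> (edge_weight E) S =
      (\<Sum>p | p permutes S. w p * of_bool (D p \<subseteq> E))" for E
    unfolding signed_perm_sum_def prod_edge_weight[OF fin] w_def D_def by (simp only: mult.assoc)
  have bool: "of_bool (C \<subseteq> E) * (w p * of_bool (D p \<subseteq> E)) = w p * of_bool (C \<union> D p \<subseteq> E)" for E p
    by simp
  have "graph_expectation n (\<lambda>E. of_bool (C \<subseteq> E) * signed_perm_sum \<epsilon> (edge_weight E) S) =
      (\<Sum>p | p permutes S. w p * [:measure (G n) {E. C \<union> D p \<subseteq> E}:])"
    unfolding sps sum_distrib_left bool
    by (simp only: graph_expectation_sum graph_expectation_mult_const graph_expectation_supset)
  also have "\<dots> = (\<Sum>p | p permutes S.
      w p * [:measure (G n) {E. C \<subseteq> E} * measure (G n) {E. D p \<subseteq> E}:])"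
  proof (rule sum.cong[OF refl])
    fix p assume "p \<in> {p. p permutes S}"
    then have "D p \<subseteq> edges_on (Suc ` S)" unfolding D_def by (simp add: permutation_edges_subset)
    then show "w p * [:measure (G n) {E. C \<union> D p \<subseteq> E}:] =
        w p * [:measure (G n) {E. C \<subseteq> E} * measure (G n) {E. D p \<subseteq> E}:]"
      using indep_edges[OF assms] by simp
  qed
  also have "\<dots> = Polynomial.smult (measure (G n) {E. C \<subseteq> E})
      (\<Sum>p | p permutes S. w p * [:measure (G n) {E. D p \<subseteq> E}:])"
    by (simp add: smult_sum_right)
  also have "(\<Sum>p | p permutes S. w p * [:measure (G n) {E. D p \<subseteq> E}:]) =
      graph_expectation n (\<lambda>E. signed_perm_sum \<epsilon> (edge_weight E) S)"
    unfolding sps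
    by (simp only: graph_expectation_sum graph_expectation_mult_const graph_expectation_supset)
  finally show ?thesis .
qed

text \<open>One step of uncovering the cycle through \<open>a\<close>: \<open>ys\<close> is the path
  from \<open>a\<close> seen so far, and \<open>S\<close> holds \<open>a\<close> and the vertices
  still available. Either the path closes into a cycle, which is independent of the edges on
  \<open>S - {a}\<close>, or it continues to some \<open>b\<close>, which then leaves
  \<open>S\<close>.\<close>

lemma graph_expectation_path_step:
  fixes \<epsilon> :: real
  assumes "\<epsilon> * \<epsilon> = 1" "distinct ys" "2 \<le> length ys" "hd ys = a" "S \<inter> set ys = {a}"
    and "set ys \<subseteq> {0..<n}" "S \<subseteq> {0..<n}"
  shows "graph_expectation n (\<lambda>E. of_bool (path_edges (map Suc ys) \<subseteq> E) *
      signed_perm_sum [:\<epsilon>:] ((edge_weight E)(a := edge_weight E (last ys))) S) =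
    Polynomial.smult (Theta G n (length ys))
      (graph_expectation n (\<lambda>E. signed_perm_sum [:\<epsilon>:] (edge_weight E) (S - {a}))) +
    Polynomial.smult \<epsilon> (\<Sum>b\<in>S - {a}. graph_expectation n (\<lambda>E.
      of_bool (path_edges (map Suc (ys @ [b])) \<subseteq> E) *
      signed_perm_sum [:\<epsilon>:] ((edge_weight E)(a := edge_weight E (last (ys @ [b])))) (S - {b})))"
proof -
  let ?c = "last ys"
  let ?F = "\<lambda>E b. signed_perm_sum [:\<epsilon>:] ((edge_weight E)(a := edge_weight E b)) (S - {b})"
  have ne: "ys \<noteq> []" using assms(3) by auto
  \<comment> \<open>The end of the path differs from \<open>a\<close>, so the entry that closes the
    cycle is an edge indicator and not the diagonal entry. The same is checked below for the entry
    leading to \<open>b\<close>.\<close>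
  have ca: "?c \<noteq> a"
    using assms(2-4) by (cases ys; cases "tl ys") (auto split: if_splits)
  have fin: "finite S" using assms(7) finite_subset by blast
  have aS: "a \<in> S" using assms(5) by blast
  have \<epsilon>: "[:\<epsilon>:] * [:\<epsilon>:] = 1" using assms(1) by (simp add: pCons_one)
  have cyc: "cycle_edges (map Suc ys) = insert {Suc ?c, Suc a} (path_edges (map Suc ys))"
    using ne assms(4) by (simp add: cycle_edges_eq_path_edges last_map hd_map)
  have path: "path_edges (map Suc (ys @ [b])) = insert {Suc ?c, Suc b} (path_edges (map Suc ys))" for b
    using path_edges_snoc[of "map Suc ys" "Suc b"] ne by (simp add: last_map)
  have "of_bool (path_edges (map Suc ys) \<subseteq> E) *
      signed_perm_sum [:\<epsilon>:] ((edge_weight E)(a := edge_weight E ?c)) S =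
      of_bool (cycle_edges (map Suc ys) \<subseteq> E) * signed_perm_sum [:\<epsilon>:] (edge_weight E) (S - {a}) +
      [:\<epsilon>:] * (\<Sum>b\<in>S - {a}. of_bool (path_edges (map Suc (ys @ [b])) \<subseteq> E) * ?F E b)" for E
  proof -
    let ?p = "of_bool (path_edges (map Suc ys) \<subseteq> E) :: real poly"
    have "?p * edge_weight E ?c a = of_bool (cycle_edges (map Suc ys) \<subseteq> E)"
      using ca by (auto simp: edge_weight_def cyc)
    moreover have "?p * edge_weight E ?c b = of_bool (path_edges (map Suc (ys @ [b])) \<subseteq> E)"
      if "b \<in> S - {a}" for b
    proof -
      have "?c \<noteq> b" using that assms(5) ne last_in_set by fastforce
      then show ?thesis by (auto simp: edge_weight_def path simp del: map_append)
    qed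
    then have "?p * (\<Sum>b\<in>S - {a}. edge_weight E ?c b * ?F E b) =
        (\<Sum>b\<in>S - {a}. of_bool (path_edges (map Suc (ys @ [b])) \<subseteq> E) * ?F E b)"
      unfolding sum_distrib_left mult.assoc[symmetric] by (intro sum.cong refl) simp
    ultimately show ?thesis
      unfolding signed_perm_sum_contract[OF fin aS \<epsilon>]
      by (simp only: distrib_left mult.assoc[symmetric] mult.commute[of ?p "[:\<epsilon>:]"])
         (simp only: mult.assoc)
  qed
  moreover have "graph_expectation n (\<lambda>E. of_bool (cycle_edges (map Suc ys) \<subseteq> E) *
      signed_perm_sum [:\<epsilon>:] (edge_weight E) (S - {a})) =
    Polynomial.smult (Theta G n (length ys))
      (graph_expectation n (\<lambda>E. signed_perm_sum [:\<epsilon>:] (edge_weight E) (S - {a})))"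
  proof -
    have sub: "set (map Suc ys) \<subseteq> {1..n}" "Suc ` (S - {a}) \<subseteq> {1..n}"
      using assms(6,7) by auto
    have disj: "set (map Suc ys) \<inter> Suc ` (S - {a}) = {}" using assms(5) by auto
    have dist: "distinct (map Suc ys)" "2 \<le> length (map Suc ys)"
      using assms(2,3) by (auto simp: distinct_map)
    show ?thesis
      using graph_expectation_indep[OF sub disj cycle_edges_subset_edges_on[OF dist]]
        prob_cycle[OF dist(1) sub(1) dist(2)] by simp
  qed
  ultimately show ?thesis
    by (simp only: graph_expectation_add graph_expectation_mult_const graph_expectation_sum
        last_snoc) simp
qed

text \<open>Here \<open>k\<close> vertices besides \<open>a\<close> are still available, and
  \<open>j\<close> counts those that the path visits before it closes. They can be chosen in order
  in \<open>fact k / fact (k - j)\<close> ways, each visit contributes a factor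
  \<open>\<epsilon>\<close>, and \<open>k - j\<close> vertices remain outside the cycle.\<close>

lemma graph_expectation_path:
  fixes \<epsilon> :: real
  assumes "\<epsilon> * \<epsilon> = 1" "distinct ys" "2 \<le> length ys" "hd ys = a" "S \<inter> set ys = {a}"
    and "set ys \<subseteq> {0..<n}" "S \<subseteq> {0..<n}" "card S = Suc k"
    and "\<And>T. T \<subseteq> S - {a} \<Longrightarrow>
      graph_expectation n (\<lambda>E. signed_perm_sum [:\<epsilon>:] (edge_weight E) T) = H (card T)"
  shows "graph_expectation n (\<lambda>E. of_bool (path_edges (map Suc ys) \<subseteq> E) *
      signed_perm_sum [:\<epsilon>:] ((edge_weight E)(a := edge_weight E (last ys))) S) =
    (\<Sum>j\<le>k. Polynomial.smult (\<epsilon> ^ j * (fact k / fact (k - j)) * Theta G n (length ys + j)) (H (k - j)))"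
  using assms(2-)
proof (induction k arbitrary: ys S)
  case 0
  have "a \<in> S" using 0(4) by blast
  then have "S - {a} = {}" using 0(7) by (auto simp: card_Suc_eq)
  then show ?case
    using graph_expectation_path_step[OF assms(1) 0(1-6)] 0(8)[of "{}"]
    by (simp only: sum.empty subset_refl card.empty) simp
next
  case (Suc k)
  have aS: "a \<in> S" using Suc.prems(4) by blast
  have fin: "finite S" using Suc.prems(6) finite_subset by blast
  let ?t = "\<lambda>j. Polynomial.smult (\<epsilon> ^ j * (fact (Suc k) / fact (Suc k - j)) * Theta G n (length ys + j))
    (H (Suc k - j))"
  let ?u = "\<lambda>j. Polynomial.smult (\<epsilon> ^ j * (fact k / fact (k - j)) * Theta G n (Suc (length ys) + j))
    (H (k - j))"
  have card: "card (S - {a}) = Suc k" using aS fin Suc.prems(7) by simp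
  have "graph_expectation n (\<lambda>E. of_bool (path_edges (map Suc (ys @ [b])) \<subseteq> E) *
      signed_perm_sum [:\<epsilon>:] ((edge_weight E)(a := edge_weight E (last (ys @ [b])))) (S - {b})) =
      (\<Sum>j\<le>k. ?u j)" if b: "b \<in> S - {a}" for b
  proof -
    have "b \<notin> set ys" using b Suc.prems(4) by blast
    moreover have "hd (ys @ [b]) = a" using Suc.prems(2,3) by (cases ys) auto
    moreover have "(S - {b}) \<inter> set (ys @ [b]) = {a}" using Suc.prems(4) b by auto
    moreover have "card (S - {b}) = Suc k" using b fin Suc.prems(7) by simp
    ultimately have "graph_expectation n (\<lambda>E. of_bool (path_edges (map Suc (ys @ [b])) \<subseteq> E) *
        signed_perm_sum [:\<epsilon>:] ((edge_weight E)(a := edge_weight E (last (ys @ [b])))) (S - {b})) =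
        (\<Sum>j\<le>k. Polynomial.smult (\<epsilon> ^ j * (fact k / fact (k - j)) * Theta G n (length (ys @ [b]) + j))
          (H (k - j)))"
      using Suc.prems b by (intro Suc.IH Suc.prems(8)) auto
    then show ?thesis by (simp only: length_append_singleton)
  qed
  then have "(\<Sum>b\<in>S - {a}. graph_expectation n (\<lambda>E. of_bool (path_edges (map Suc (ys @ [b])) \<subseteq> E) *
      signed_perm_sum [:\<epsilon>:] ((edge_weight E)(a := edge_weight E (last (ys @ [b])))) (S - {b}))) =
      (\<Sum>b\<in>S - {a}. \<Sum>j\<le>k. ?u j)"
    by (intro sum.cong refl)
  then have "graph_expectation n (\<lambda>E. of_bool (path_edges (map Suc ys) \<subseteq> E) *
      signed_perm_sum [:\<epsilon>:] ((edge_weight E)(a := edge_weight E (last ys))) S) =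
      Polynomial.smult (Theta G n (length ys)) (H (Suc k)) +
      Polynomial.smult \<epsilon> (\<Sum>b\<in>S - {a}. \<Sum>j\<le>k. ?u j)"
    unfolding graph_expectation_path_step[OF assms(1) Suc.prems(1-6)]
    by (simp only: Suc.prems(8)[OF subset_refl] card)
  \<comment> \<open>The inner sum is the same for all \<open>Suc k\<close> choices of
    \<open>b\<close>. The factor \<open>Suc k\<close> completes \<open>fact k\<close> to
    \<open>fact (Suc k)\<close>, and the extra \<open>\<epsilon>\<close> raises the power, so that
    term \<open>j\<close> becomes term \<open>Suc j\<close> of the claim.\<close>
  also have "Polynomial.smult \<epsilon> (\<Sum>b\<in>S - {a}. \<Sum>j\<le>k. ?u j) =
      (\<Sum>j\<le>k. Polynomial.smult (\<epsilon> * real (Suc k)) (?u j))"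
    unfolding sum_constant card smult_sum_right[symmetric] of_nat_poly by (simp add: mult.commute)
  also have "\<dots> = (\<Sum>j\<le>k. ?t (Suc j))"
    by (intro sum.cong refl) (simp add: mult_ac)
  also have "Polynomial.smult (Theta G n (length ys)) (H (Suc k)) = ?t 0" by simp
  also have "?t 0 + (\<Sum>j\<le>k. ?t (Suc j)) = (\<Sum>j\<le>Suc k. ?t j)"
    by (rule sum.atMost_Suc_shift[symmetric])
  finally show ?case .
qed

text \<open>The first contraction is done by hand, because closing at once means that
  \<open>a\<close> is a fixed point, which contributes the variable instead of a cycle probability.
  Afterwards the path \<open>[a, b]\<close> has length 2 and \<open>graph_expectation_path\<close>
  takes over. The hypothesis on proper subsets is what an induction on the size of \<open>S\<close>
  can supply.\<close>

lemma graph_expectation_signed_perm_sum: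
  fixes \<epsilon> :: real
  assumes "\<epsilon> * \<epsilon> = 1" "S \<subseteq> {0..<n}" "S \<noteq> {}"
    and H: "\<And>T. T \<subset> S \<Longrightarrow>
      graph_expectation n (\<lambda>E. signed_perm_sum [:\<epsilon>:] (edge_weight E) T) = H (card T)"
  shows "graph_expectation n (\<lambda>E. signed_perm_sum [:\<epsilon>:] (edge_weight E) S) =
    [:0, 1:] * H (card S - 1) +
    (\<Sum>q = 2..card S. Polynomial.smult
      (\<epsilon> ^ (q - 1) * (fact (card S - 1) / fact (card S - q)) * Theta G n q) (H (card S - q)))"
proof -
  obtain a where aS: "a \<in> S" using assms(3) by blast
  have fin: "finite S" using assms(2) finite_subset by blast
  have \<epsilon>: "[:\<epsilon>:] * [:\<epsilon>:] = 1" using assms(1) by (simp add: pCons_one)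
  have card: "card (S - {a}) = card S - 1" using aS fin by simp
  let ?F = "\<lambda>E b. of_bool (path_edges (map Suc [a, b]) \<subseteq> E) *
    signed_perm_sum [:\<epsilon>:] ((edge_weight E)(a := edge_weight E (last [a, b]))) (S - {b})"
  have path: "path_edges [Suc a, Suc b] = {{Suc a, Suc b}}" for b
    using path_edges_snoc[of "[Suc a]" "Suc b"] by simp
  have "signed_perm_sum [:\<epsilon>:] (edge_weight E) S =
      [:0, 1:] * signed_perm_sum [:\<epsilon>:] (edge_weight E) (S - {a}) + [:\<epsilon>:] * (\<Sum>b\<in>S - {a}. ?F E b)" for E
  proof -
    \<comment> \<open>The unmodified matrix is the case \<open>c = a\<close> of the contraction,
      where replacing row \<open>a\<close> changes nothing.\<close>
    have "signed_perm_sum [:\<epsilon>:] (edge_weight E) S =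
        edge_weight E a a * signed_perm_sum [:\<epsilon>:] (edge_weight E) (S - {a}) +
        [:\<epsilon>:] * (\<Sum>b\<in>S - {a}. edge_weight E a b *
          signed_perm_sum [:\<epsilon>:] ((edge_weight E)(a := edge_weight E b)) (S - {b}))"
      using signed_perm_sum_contract[OF fin aS \<epsilon>, of "edge_weight E" a] by (simp only: fun_upd_triv)
    moreover have "edge_weight E a b = of_bool (path_edges (map Suc [a, b]) \<subseteq> E)" if "b \<in> S - {a}" for b
      using that by (auto simp: edge_weight_def path)
    moreover have "edge_weight E a a = [:0, 1:]" by (simp add: edge_weight_def)
    ultimately show ?thesis by (simp only: last.simps list.distinct simp_thms if_False if_True cong: sum.cong)
  qed
  then have "graph_expectation n (\<lambda>E. signed_perm_sum [:\<epsilon>:] (edge_weight E) S) =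
      [:0, 1:] * H (card S - 1) + [:\<epsilon>:] * (\<Sum>b\<in>S - {a}. graph_expectation n (\<lambda>E. ?F E b))"
    using H[of "S - {a}"] aS
    by (simp only: graph_expectation_add graph_expectation_mult_const graph_expectation_sum card)
       auto
  also have "[:\<epsilon>:] * (\<Sum>b\<in>S - {a}. graph_expectation n (\<lambda>E. ?F E b)) =
      (\<Sum>q = 2..card S. Polynomial.smult
        (\<epsilon> ^ (q - 1) * (fact (card S - 1) / fact (card S - q)) * Theta G n q) (H (card S - q)))"
  proof (cases "card S \<le> 1")
    case True
    then have "S - {a} = {}" using card fin by (metis card_0_eq diff_is_0_eq finite_Diff)
    then show ?thesis using True by (simp only: sum.empty) simp
  next
    case False
    \<comment> \<open>Once \<open>a\<close> and \<open>b\<close> are on the path, \<open>k\<close>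
      vertices are left to visit.\<close>
    then obtain k where k: "card S = Suc (Suc k)"
      by (cases "card S"; cases "card S - 1") auto
    let ?u = "\<lambda>j. Polynomial.smult (\<epsilon> ^ j * (fact k / fact (k - j)) * Theta G n (2 + j)) (H (k - j))"
    have "graph_expectation n (\<lambda>E. ?F E b) = (\<Sum>j\<le>k. ?u j)" if b: "b \<in> S - {a}" for b
    proof -
      have "graph_expectation n (\<lambda>E. signed_perm_sum [:\<epsilon>:] (edge_weight E) T) = H (card T)"
        if "T \<subseteq> S - {b} - {a}" for T
        using that b by (intro H) auto
      then have "graph_expectation n (\<lambda>E. ?F E b) = (\<Sum>j\<le>k. Polynomial.smult
          (\<epsilon> ^ j * (fact k / fact (k - j)) * Theta G n (length [a, b] + j)) (H (k - j)))"
        using b aS assms(2) k fin by (intro graph_expectation_path[OF assms(1)]) auto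
      moreover have "length [a, b] = 2" by simp
      ultimately show ?thesis by (simp only:)
    qed
    then have "[:\<epsilon>:] * (\<Sum>b\<in>S - {a}. graph_expectation n (\<lambda>E. ?F E b)) =
        [:\<epsilon>:] * (\<Sum>b\<in>S - {a}. \<Sum>j\<le>k. ?u j)"
      by (intro arg_cong2[where f = "(*)"] sum.cong refl)
    also have "\<dots> = (\<Sum>j\<le>k. Polynomial.smult (\<epsilon> * real (Suc k)) (?u j))"
      unfolding sum_constant card k smult_sum_right[symmetric] of_nat_poly by (simp add: mult.commute)
    \<comment> \<open>Visiting \<open>j\<close> vertices beyond \<open>a\<close> and
      \<open>b\<close> gives a cycle of length \<open>q = j + 2\<close>; the terms are rewritten in
      \<open>j + 2\<close> so that the index can be shifted.\<close>
    also have "\<dots> = (\<Sum>j = 0..k. Polynomial.smult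
        (\<epsilon> ^ (j + 2 - 1) * (fact (Suc k) / fact (Suc (Suc k) - (j + 2))) * Theta G n (j + 2))
        (H (Suc (Suc k) - (j + 2))))"
      unfolding atMost_atLeast0 by (intro sum.cong refl) (simp add: mult_ac)
    also have "\<dots> = (\<Sum>q = 0 + 2..k + 2. Polynomial.smult
        (\<epsilon> ^ (q - 1) * (fact (Suc k) / fact (Suc (Suc k) - q)) * Theta G n q) (H (Suc (Suc k) - q)))"
      by (rule sum.shift_bounds_cl_nat_ivl[symmetric])
    also have "0 + 2 = (2 :: nat)" by simp
    also have "k + 2 = Suc (Suc k)" by simp
    finally show ?thesis unfolding k diff_Suc_1 .
  qed
  finally show ?thesis .
qed

text \<open>The recurrence itself shows that the expectation over a vertex set depends only on the size of
  that set, so no relabelling of permutations is needed.\<close>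

lemma graph_expectation_card:
  fixes \<epsilon> :: real
  assumes "\<epsilon> * \<epsilon> = 1" "S \<subseteq> {0..<n}"
  shows "graph_expectation n (\<lambda>E. signed_perm_sum [:\<epsilon>:] (edge_weight E) S) =
    graph_expectation (card S) (\<lambda>E. signed_perm_sum [:\<epsilon>:] (edge_weight E) {0..<card S})"
  using assms(2)
\<comment> \<open>With \<open>n\<close> arbitrary, the induction hypothesis applies both in the
  given graph and in the graph on \<open>card S\<close> vertices.\<close>
proof (induction "card S" arbitrary: S n rule: less_induct)
  case less
  define H where "H = (\<lambda>m. graph_expectation m (\<lambda>E. signed_perm_sum [:\<epsilon>:] (edge_weight E) {0..<m}))"
  have fin: "finite S" using less.prems finite_subset by blast
  show ?case
  proof (cases "S = {}")
    case True
    have "graph_expectation m (\<lambda>E. 1) = [:1:]" for m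
      using graph_expectation_supset[of m "{}"] prob_space.prob_space[OF prob_space_graph, of m]
      by (simp add: space_graph)
    then show ?thesis using True by simp
  next
    case False
    have le: "card S \<le> n" using card_mono[OF _ less.prems] by simp
    have "graph_expectation n (\<lambda>E. signed_perm_sum [:\<epsilon>:] (edge_weight E) T) = H (card T)"
      if "T \<subset> S" for T
      using less.hyps[of T n] psubset_card_mono[OF fin that] that less.prems unfolding H_def by blast
    from graph_expectation_signed_perm_sum[OF assms(1) less.prems False this]
    have 1: "graph_expectation n (\<lambda>E. signed_perm_sum [:\<epsilon>:] (edge_weight E) S) =
        [:0, 1:] * H (card S - 1) + (\<Sum>q = 2..card S. Polynomial.smult
          (\<epsilon> ^ (q - 1) * (fact (card S - 1) / fact (card S - q)) * Theta G n q) (H (card S - q)))" .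
    \<comment> \<open>The recurrence is applied again, now to the full vertex set of the smaller
      graph. The two right-hand sides differ only in \<open>Theta G n q\<close> against
      \<open>Theta G (card S) q\<close>, which \<open>Theta_stable\<close> identifies.\<close>
    have "graph_expectation (card S) (\<lambda>E. signed_perm_sum [:\<epsilon>:] (edge_weight E) T) = H (card T)"
      if "T \<subset> {0..<card S}" for T
      using less.hyps[of T "card S"] psubset_card_mono[OF _ that] that unfolding H_def by auto
    from graph_expectation_signed_perm_sum[OF assms(1) subset_refl _ this] False fin
    have 2: "H (card S) =
        [:0, 1:] * H (card S - 1) + (\<Sum>q = 2..card S. Polynomial.smult
          (\<epsilon> ^ (q - 1) * (fact (card S - 1) / fact (card S - q)) * Theta G (card S) q) (H (card S - q)))"
      by (simp add: H_def card_gt_0_iff)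
    have "Theta G n q = Theta G (card S) q" if "q \<in> {2..card S}" for q
      using Theta_stable[of q n] Theta_stable[of q "card S"] that le by simp
    with 1 2 have "graph_expectation n (\<lambda>E. signed_perm_sum [:\<epsilon>:] (edge_weight E) S) = H (card S)"
      by (simp only: cong: sum.cong)
    then show ?thesis unfolding H_def .
  qed
qed

section \<open>The recurrences for the averaged polynomials\<close>

lemma graph_expectation_recurrence:
  fixes \<epsilon> :: real
  defines "H \<equiv> \<lambda>m. graph_expectation m (\<lambda>E. signed_perm_sum [:\<epsilon>:] (edge_weight E) {0..<m})"
  assumes "\<epsilon> * \<epsilon> = 1" "1 \<le> n"
  shows "H n = [:0, 1:] * H (n - 1) +
    (\<Sum>q = 2..n. Polynomial.smult (\<epsilon> ^ (q - 1) * (fact (n - 1) / fact (n - q)) * Theta G n q) (H (n - q)))"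
proof -
  have "graph_expectation n (\<lambda>E. signed_perm_sum [:\<epsilon>:] (edge_weight E) T) = H (card T)"
    if "T \<subset> {0..<n}" for T
    using graph_expectation_card[OF assms(2), of T n] that unfolding H_def by blast
  from graph_expectation_signed_perm_sum[OF assms(2) subset_refl _ this] assms(3)
  show ?thesis by (simp add: H_def)
qed

lemma graph_expectation_empty:
  "graph_expectation 0 (\<lambda>E. signed_perm_sum \<epsilon> (edge_weight E) {0..<0}) = 1"
  using graph_expectation_supset[of 0 "{}"] prob_space.prob_space[OF prob_space_graph, of 0]
  by (simp add: space_graph pCons_one)

lemma Lambda_bar_eq:
  "Lambda_bar G n = graph_expectation n (\<lambda>E. signed_perm_sum [:- 1:] (edge_weight E) {0..<n})"
proof -
  have "[:- 1:] = - [:1::real:]" by simp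
  then have "[:- 1:] = (- 1 :: real poly)" unfolding pCons_one .
  then show ?thesis by (simp only: Lambda_bar_def expected_poly_graph det_xI_plus)
qed

lemma Gamma_bar_eq:
  "Gamma_bar G n = graph_expectation n (\<lambda>E. signed_perm_sum [:1:] (edge_weight E) {0..<n})"
  by (simp only: Gamma_bar_def expected_poly_graph permanent_xI_plus pCons_one)

lemma bar_recurrences:
  "(\<forall>n\<ge>1.
      Lambda_bar G n = [:0, 1:] * Lambda_bar G (n - 1)
        + (\<Sum>q = 2..n. Polynomial.smult ((- 1) ^ (q - 1) * (fact (n - 1) / fact (n - q)) * Theta G n q)
             (Lambda_bar G (n - q))) \<and>
      Gamma_bar G n = [:0, 1:] * Gamma_bar G (n - 1)
        + (\<Sum>q = 2..n. Polynomial.smult (fact (n - 1) / fact (n - q) * Theta G n q)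
             (Gamma_bar G (n - q)))) \<and>
    Lambda_bar G 0 = 1 \<and> Gamma_bar G 0 = 1"
  using graph_expectation_recurrence[of "- 1"] graph_expectation_recurrence[of 1]
  unfolding Lambda_bar_eq Gamma_bar_eq graph_expectation_empty power_one mult_1 by simp

end

section \<open>The two graph models\<close>

lemma cycle_edges_upt_subset: "2 \<le> q \<Longrightarrow> cycle_edges [1..<Suc q] \<subseteq> edges_on {1..q}"
  using cycle_edges_subset_edges_on[of "[1..<Suc q]"] by (simp del: upt_Suc add: atLeastLessThanSuc_atLeastAtMost)

lemma edges_on_disjoint: "V \<inter> W = {} \<Longrightarrow> edges_on V \<inter> edges_on W = {}"
  by (auto simp: edges_on_def doubleton_eq_iff)

section \<open>The Erdos-Renyi model\<close>

lemma random_graph_family_erdos_renyi: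
  assumes "0 \<le> p" "p \<le> 1"
  shows "random_graph_family (erdos_renyi p)"
proof (rule random_graph_family.intro)
  fix n :: nat
  show "prob_space (erdos_renyi p n)"
    unfolding erdos_renyi_def by (rule measure_pmf.prob_space_axioms)
  show "sets (erdos_renyi p n) = UNIV" by (simp add: erdos_renyi_def)
  show "AE E in erdos_renyi p n. E \<subseteq> all_edges n"
    unfolding erdos_renyi_def AE_measure_pmf_iff by auto
  show "measure (erdos_renyi p n) {E. cycle_edges ys \<subseteq> E} = Theta (erdos_renyi p) n (length ys)"
    if "distinct ys" "set ys \<subseteq> {1..n}" "2 \<le> length ys" for ys
    using Theta_erdos_renyi[OF assms that] .
  show "Theta (erdos_renyi p) n q = Theta (erdos_renyi p) q q" if "2 \<le> q" "q \<le> n" for q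
  proof -
    have "cycle_edges [1..<Suc q] \<subseteq> all_edges q" "all_edges q \<subseteq> all_edges n"
      using cycle_edges_upt_subset[OF that(1)] that(2)
      by (auto simp: all_edges_eq_edges_on simp del: upt_Suc intro: edges_on_mono[THEN subsetD, rotated])
    then show ?thesis
      unfolding Theta_def using prob_erdos_renyi_supset[OF assms] by (metis subset_trans)
  qed
  show "measure (erdos_renyi p n) {E. C \<union> D \<subseteq> E} =
      measure (erdos_renyi p n) {E. C \<subseteq> E} * measure (erdos_renyi p n) {E. D \<subseteq> E}"
    if "V \<subseteq> {1..n}" "W \<subseteq> {1..n}" "V \<inter> W = {}" "C \<subseteq> edges_on V" "D \<subseteq> edges_on W" for V W C D
  proof -
    have sub: "C \<subseteq> all_edges n" "D \<subseteq> all_edges n"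
      using that edges_on_mono unfolding all_edges_eq_edges_on by blast+
    then have fin: "finite C" "finite D" by (auto intro: finite_subset)
    \<comment> \<open>Disjoint vertex sets carry disjoint edge sets, so the exponents of
      \<open>p\<close> add up.\<close>
    have "C \<inter> D = {}" using edges_on_disjoint[OF that(3)] that(4,5) by blast
    with fin have "card (C \<union> D) = card C + card D" by (rule card_Un_disjoint)
    moreover have "C \<union> D \<subseteq> all_edges n" using sub by blast
    ultimately show ?thesis
      using sub prob_erdos_renyi_supset[OF assms, of _ n] by (metis power_add)
  qed
qed

section \<open>The geometric model\<close>

definition edges_short :: "ereal \<Rightarrow> real \<Rightarrow> nat set set \<Rightarrow> (nat \<Rightarrow> real ^ 'd::finite) \<Rightarrow> bool" where
  "edges_short \<sigma> r C x \<longleftrightarrow> (\<forall>i j. {i, j} \<in> C \<longrightarrow> torus_dist \<sigma> (x i) (x j) \<le> r)"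

text \<open>Unlike \<open>geometric_edges\<close>, this predicate refers to no range of vertices. It
  depends only on the points of the vertices that \<open>C\<close> touches, so it can be evaluated
  on the product over any vertex set containing them.\<close>

lemma edges_short_cong:
  assumes "C \<subseteq> edges_on V" "\<And>i. i \<in> V \<Longrightarrow> x i = y i"
  shows "edges_short \<sigma> r C x \<longleftrightarrow> edges_short \<sigma> r C y"
proof -
  have "i \<in> V \<and> j \<in> V" if "{i, j} \<in> C" for i j
    using that assms(1) by (fastforce simp: edges_on_def doubleton_eq_iff)
  then show ?thesis using assms(2) unfolding edges_short_def by metis
qed

lemma edges_short_measurable:
  assumes "C \<subseteq> edges_on V" "finite V"
  shows "{x \<in> space (\<Pi>\<^sub>M i\<in>V. (torus_uniform :: (real ^ 'd::finite) measure)). edges_short \<sigma> r C x}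
    \<in> sets (\<Pi>\<^sub>M i\<in>V. torus_uniform)"
proof -
  let ?M = "\<Pi>\<^sub>M i\<in>V. (torus_uniform :: (real ^ 'd) measure)"
  have comp [measurable]: "(\<lambda>x. x i) \<in> borel_measurable ?M" if "i \<in> V" for i
    using measurable_component_singleton[OF that, of "\<lambda>_. torus_uniform :: (real ^ 'd) measure"]
    by (simp add: measurable_cong_sets[OF refl sets_torus_uniform])
  \<comment> \<open>Restricting the quantifiers to the finite set \<open>V\<close> exhibits the
    event as a finite intersection.\<close>
  have "edges_short \<sigma> r C x \<longleftrightarrow>
      (\<forall>i\<in>V. \<forall>j\<in>V. {i, j} \<in> C \<longrightarrow> torus_dist \<sigma> (x i) (x j) \<le> r)" for x :: "nat \<Rightarrow> real ^ 'd"
    using assms(1) unfolding edges_short_def by (fastforce simp: edges_on_def doubleton_eq_iff)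
  moreover have "{x \<in> space ?M. \<forall>i\<in>V. \<forall>j\<in>V. {i, j} \<in> C \<longrightarrow> torus_dist \<sigma> (x i) (x j) \<le> r} \<in> sets ?M"
  proof (intro sets.sets_Collect_finite_All assms(2) sets.sets_Collect_imp)
    fix i j assume ij: "i \<in> V" "j \<in> V"
    note [measurable] = comp[OF ij(1)] comp[OF ij(2)]
    show "{x \<in> space ?M. torus_dist \<sigma> (x i) (x j) \<le> r} \<in> sets ?M" by measurable
  qed auto
  ultimately show ?thesis by simp
qed

text \<open>The event depends only on the points indexed by \<open>V\<close>, and restriction to
  \<open>V\<close> maps the product measure over all vertices to the one over \<open>V\<close>. The
  result is free of \<open>n\<close>, which gives \<open>Theta_stable\<close>.\<close>

lemma prob_geometric_graph_supset:
  assumes "V \<subseteq> {1..n}" "C \<subseteq> edges_on V"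
  shows "measure (geometric_graph TYPE('d::finite) \<sigma> r n) {E. C \<subseteq> E} =
    measure (\<Pi>\<^sub>M i\<in>V. (torus_uniform :: (real ^ 'd) measure))
      {x \<in> space (\<Pi>\<^sub>M i\<in>V. torus_uniform). edges_short \<sigma> r C x}"
proof -
  let ?P = "\<lambda>V. \<Pi>\<^sub>M i\<in>V. (torus_uniform :: (real ^ 'd) measure)"
  let ?t = "\<lambda>x. restrict x V"
  have fin: "finite V" using assms(1) finite_subset by blast
  have distr: "distr (?P {1..n}) (?P V) ?t = ?P V"
    using distr_PiM_reindex[of "{1..n}" "\<lambda>_. torus_uniform :: (real ^ 'd) measure" "\<lambda>i. i" V]
      assms(1) prob_space_torus_uniform by (auto simp: restrict_def)
  have t: "?t \<in> ?P {1..n} \<rightarrow>\<^sub>M ?P V"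
    using assms(1) by (rule measurable_restrict_subset)
  have ev: "C \<subseteq> geometric_edges \<sigma> r n x \<longleftrightarrow> edges_short \<sigma> r C (?t x)" for x :: "nat \<Rightarrow> real ^ 'd"
  proof -
    have "C \<subseteq> geometric_edges \<sigma> r n x \<longleftrightarrow> edges_short \<sigma> r C x"
    proof
      assume "C \<subseteq> geometric_edges \<sigma> r n x"
      then show "edges_short \<sigma> r C x"
        unfolding edges_short_def using doubleton_in_geometric_edges[of _ _ \<sigma> r n x] by blast
    next
      assume short: "edges_short \<sigma> r C x"
      show "C \<subseteq> geometric_edges \<sigma> r n x"
      proof
        fix e assume e: "e \<in> C"
        then obtain i j where ij: "e = {i, j}" "i \<in> V" "j \<in> V" "i \<noteq> j"
          using assms(2) unfolding edges_on_def by blast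
        then show "e \<in> geometric_edges \<sigma> r n x"
          using e short assms(1) unfolding edges_short_def ij(1) doubleton_in_geometric_edges by blast
      qed
    qed
    also have "\<dots> \<longleftrightarrow> edges_short \<sigma> r C (?t x)"
      by (rule edges_short_cong[OF assms(2)]) simp
    finally show ?thesis .
  qed
  have "measure (geometric_graph TYPE('d) \<sigma> r n) {E. C \<subseteq> E} =
      measure (?P {1..n}) {x \<in> space (?P {1..n}). C \<subseteq> geometric_edges \<sigma> r n x}"
    unfolding geometric_graph_def
    by (subst measure_distr[OF geometric_edges_measurable]) (auto intro!: arg_cong[where f = "measure _"])
  also have "\<dots> = measure (?P {1..n})
      (?t -` {x \<in> space (?P V). edges_short \<sigma> r C x} \<inter> space (?P {1..n}))"
    unfolding ev using measurable_space[OF t] by (intro arg_cong[where f = "measure _"]) auto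
  also have "\<dots> = measure (distr (?P {1..n}) (?P V) ?t) {x \<in> space (?P V). edges_short \<sigma> r C x}"
    by (rule measure_distr[symmetric, OF t edges_short_measurable[OF assms(2) fin]])
  finally show ?thesis unfolding distr .
qed

text \<open>The product over \<open>V \<union> W\<close> is the image under \<open>merge\<close> of
  the pair of products over \<open>V\<close> and \<open>W\<close>. The preimage of the event is a
  rectangle, because each edge set sees only its own points.\<close>

lemma prob_edges_short_Un:
  assumes "finite V" "finite W" "V \<inter> W = {}" "C \<subseteq> edges_on V" "D \<subseteq> edges_on W"
  shows "measure (\<Pi>\<^sub>M i\<in>V \<union> W. (torus_uniform :: (real ^ 'd::finite) measure))
      {x \<in> space (\<Pi>\<^sub>M i\<in>V \<union> W. torus_uniform). edges_short \<sigma> r (C \<union> D) x} =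
    measure (\<Pi>\<^sub>M i\<in>V. (torus_uniform :: (real ^ 'd) measure))
      {x \<in> space (\<Pi>\<^sub>M i\<in>V. torus_uniform). edges_short \<sigma> r C x} *
    measure (\<Pi>\<^sub>M i\<in>W. (torus_uniform :: (real ^ 'd) measure))
      {x \<in> space (\<Pi>\<^sub>M i\<in>W. torus_uniform). edges_short \<sigma> r D x}"
proof -
  let ?P = "\<lambda>V. \<Pi>\<^sub>M i\<in>V. (torus_uniform :: (real ^ 'd) measure)"
  let ?S = "\<lambda>V C. {x \<in> space (?P V). edges_short \<sigma> r C x}"
  interpret U: prob_space "torus_uniform :: (real ^ 'd) measure" by (rule prob_space_torus_uniform)
  interpret product_sigma_finite "\<lambda>_ :: nat. torus_uniform :: (real ^ 'd) measure" by unfold_locales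
  interpret PW: prob_space "?P W" by (rule prob_space_PiM) (rule prob_space_torus_uniform)
  have CD: "C \<union> D \<subseteq> edges_on (V \<union> W)"
    using assms(4,5) edges_on_mono[of V "V \<union> W"] edges_on_mono[of W "V \<union> W"] by blast
  have "measure (?P (V \<union> W)) (?S (V \<union> W) (C \<union> D)) =
      measure (distr (?P V \<Otimes>\<^sub>M ?P W) (?P (V \<union> W)) (merge V W)) (?S (V \<union> W) (C \<union> D))"
    by (simp only: distr_merge[OF assms(3,1,2)])
  also have "\<dots> = measure (?P V \<Otimes>\<^sub>M ?P W)
      (merge V W -` ?S (V \<union> W) (C \<union> D) \<inter> space (?P V \<Otimes>\<^sub>M ?P W))"
    using assms(1,2) by (intro measure_distr measurable_merge edges_short_measurable CD) auto
  also have "merge V W -` ?S (V \<union> W) (C \<union> D) \<inter> space (?P V \<Otimes>\<^sub>M ?P W) = ?S V C \<times> ?S W D"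
  proof -
    have "edges_short \<sigma> r (C \<union> D) (merge V W (x, y)) \<longleftrightarrow> edges_short \<sigma> r C x \<and> edges_short \<sigma> r D y"
      for x y :: "nat \<Rightarrow> real ^ 'd"
    proof -
      have "edges_short \<sigma> r C (merge V W (x, y)) \<longleftrightarrow> edges_short \<sigma> r C x"
        by (rule edges_short_cong[OF assms(4)]) (simp add: merge_def)
      moreover have "edges_short \<sigma> r D (merge V W (x, y)) \<longleftrightarrow> edges_short \<sigma> r D y"
        by (rule edges_short_cong[OF assms(5)]) (use assms(3) in \<open>auto simp: merge_def\<close>)
      ultimately show ?thesis by (auto simp: edges_short_def)
    qed
    moreover have "merge V W z \<in> space (?P (V \<union> W))" if "z \<in> space (?P V \<Otimes>\<^sub>M ?P W)" for z
      using measurable_space[OF measurable_merge that] .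
    ultimately show ?thesis by (auto simp: space_pair_measure)
  qed
  also have "measure (?P V \<Otimes>\<^sub>M ?P W) (?S V C \<times> ?S W D) =
      measure (?P V) (?S V C) * measure (?P W) (?S W D)"
    unfolding measure_def PW.emeasure_pair_measure_Times[OF edges_short_measurable[OF assms(4,1)]
        edges_short_measurable[OF assms(5,2)]]
    by (rule enn2real_mult)
  finally show ?thesis .
qed

lemma random_graph_family_geometric_graph:
  "random_graph_family (geometric_graph TYPE('d::finite) \<sigma> r)"
proof (rule random_graph_family.intro)
  fix n :: nat
  let ?G = "geometric_graph TYPE('d) \<sigma> r"
  let ?M = "\<Pi>\<^sub>M i\<in>{1..n}. (torus_uniform :: (real ^ 'd) measure)"
  have prob: "prob_space ?M" by (rule prob_space_PiM) (rule prob_space_torus_uniform)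
  show "prob_space (?G n)"
    unfolding geometric_graph_def by (rule prob_space.prob_space_distr[OF prob geometric_edges_measurable])
  show "sets (?G n) = UNIV" by (simp add: geometric_graph_def)
  have "geometric_edges \<sigma> r n x \<subseteq> all_edges n" for x :: "nat \<Rightarrow> real ^ 'd"
    by (auto simp: geometric_edges_def all_edges_def)
  then show "AE E in ?G n. E \<subseteq> all_edges n"
    unfolding geometric_graph_def by (subst AE_distr_iff[OF geometric_edges_measurable]) auto
  show "measure (?G n) {E. cycle_edges ys \<subseteq> E} = Theta ?G n (length ys)"
    if "distinct ys" "set ys \<subseteq> {1..n}" "2 \<le> length ys" for ys
    using Theta_geometric_graph[OF that] .
  show "Theta ?G n q = Theta ?G q q" if "2 \<le> q" "q \<le> n" for q
  proof -
    \<comment> \<open>Both probabilities equal the one computed from the points \<open>1\<close> to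
      \<open>q\<close> alone.\<close>
    have "{1..q} \<subseteq> {1..n}" using that(2) by auto
    from prob_geometric_graph_supset[OF this cycle_edges_upt_subset[OF that(1)]]
    show ?thesis
      unfolding Theta_def prob_geometric_graph_supset[OF subset_refl cycle_edges_upt_subset[OF that(1)]] .
  qed
  show "measure (?G n) {E. C \<union> D \<subseteq> E} = measure (?G n) {E. C \<subseteq> E} * measure (?G n) {E. D \<subseteq> E}"
    if VW: "V \<subseteq> {1..n}" "W \<subseteq> {1..n}" "V \<inter> W = {}" "C \<subseteq> edges_on V" "D \<subseteq> edges_on W" for V W C D
  proof -
    have CD: "C \<union> D \<subseteq> edges_on (V \<union> W)"
      using VW(4,5) edges_on_mono[of V "V \<union> W"] edges_on_mono[of W "V \<union> W"] by blast
    have sub: "V \<union> W \<subseteq> {1..n}" and fin: "finite V" "finite W"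
      using VW(1,2) finite_subset by blast+
    show ?thesis
      unfolding prob_geometric_graph_supset[OF sub CD] prob_geometric_graph_supset[OF VW(1,4)]
        prob_geometric_graph_supset[OF VW(2,5)]
      by (rule prob_edges_short_Un[OF fin VW(3-5)])
  qed
qed

theorem theorem2:
  fixes G :: "nat \<Rightarrow> nat set set measure"
  assumes "(\<exists>p. 0 < p \<and> p \<le> 1 \<and> G = erdos_renyi p) \<or>
    (\<exists>\<sigma> r. 1 \<le> \<sigma> \<and> 0 < r \<and> r \<le> 1 / 2 \<and> G = geometric_graph TYPE('d::finite) \<sigma> r)"
  shows "(\<forall>n\<ge>1.
      Lambda_bar G n = [:0, 1:] * Lambda_bar G (n - 1)
        + (\<Sum>q = 2..n. Polynomial.smult ((- 1) ^ (q - 1) * (fact (n - 1) / fact (n - q)) * Theta G n q)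
             (Lambda_bar G (n - q))) \<and>
      Gamma_bar G n = [:0, 1:] * Gamma_bar G (n - 1)
        + (\<Sum>q = 2..n. Polynomial.smult (fact (n - 1) / fact (n - q) * Theta G n q)
             (Gamma_bar G (n - q)))) \<and>
    Lambda_bar G 0 = 1 \<and> Gamma_bar G 0 = 1"
proof -
  have "random_graph_family G"
    using assms random_graph_family_erdos_renyi random_graph_family_geometric_graph by fastforce
  then show ?thesis by (rule random_graph_family.bar_recurrences)
qed

end
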